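(* Let $f$ and $a$ be tropical meromorphic functions, $f$ non-constant, such that $m(r,a)=o(T(r,f))$. If $$m\big(r,1_\circ\oslash(f\oplus a)\big)=o(T(r,f)),$$ then $$\begin{aligned}T(r,f)=\;&N\big(r,1_\circ\oslash(f\oplus a)\big)+J\big(r,1_\circ\oslash(f\oplus a)\big)+N(r,f)-N(r,f\oplus a)\\&+J(r,f)-J(r,f\oplus a)+o(T(r,f)).\end{aligned}$$ All asymptotics are as $r\to\infty$, without exceptional set.
   Context: $a\oplus b=\max\{a,b\}$ (pointwise), $1_\circ=0$, $a\oslash b=a-b$, so $1_\circ\oslash(f\oplus a)=-\max\{f,a\}$; $t^+=\max\{t,0\}$. A tropical meromorphic function is a continuous piecewise linear function $f:\mathbb{R}\to\mathbb{R}$ (finitely many affine pieces on each bounded interval). Put $\omega_f(x)=\lim_{\varepsilon\to0^+}(f'(x+\varepsilon)-f'(x-\varepsilon))$; $x$ is a root if $\omega_f(x)>0$, a pole if $\omega_f(x)<0$, with multiplicity $\tau_f(x)=|\omega_f(x)|$. $m(r,f)=\frac12(f(r)^++f(-r)^+)$; $N(r,f)=\frac12\sum_{|b|<r}\tau_f(b)(r-|b|)$ summed over the poles $b$ of $f$ in $(-r,r)$; $J(r,f)$ is the jump counting function, i.e. half the sum of the heights $|f(x+)-f(x-)|$ of the negative jumps of $f$ in $[-r,r]$ (discontinuities at which $f$ jumps down when moving away from the origin), which is $0$ when $f$ has no discontinuities; $T(r,f)=m(r,f)+N(r,f)+J(r,f)$. *)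

theory Defs
  imports "HOL-Analysis.Analysis" "HOL-Library.Landau_Symbols"
begin

definition trop_add :: "(real \<Rightarrow> real) \<Rightarrow> (real \<Rightarrow> real) \<Rightarrow> real \<Rightarrow> real"
    (infixl \<open>\<oplus>\<close> 65)
  where "f \<oplus> g = (\<lambda>x. max (f x) (g x))"

definition trop_div :: "(real \<Rightarrow> real) \<Rightarrow> (real \<Rightarrow> real) \<Rightarrow> real \<Rightarrow> real"
    (infixl \<open>\<oslash>\<close> 70)
  where "f \<oslash> g = (\<lambda>x. f x - g x)"

definition trop_one :: "real \<Rightarrow> real"
    (\<open>\<one>\<^sub>\<circ>\<close>)
  where "\<one>\<^sub>\<circ> = (\<lambda>_. 0)"

text \<open>The affine pieces on a bounded interval are a finite cover of it by (possibly degenerate)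
  subintervals on each of which the function is affine.\<close>

definition trop_meromorphic :: "(real \<Rightarrow> real) \<Rightarrow> bool"
  where "trop_meromorphic f \<longleftrightarrow>
    continuous_on UNIV f \<and>
    (\<forall>a b. \<exists>\<I>. finite \<I> \<and> \<Union>\<I> = {a..b} \<and>
      (\<forall>I\<in>\<I>. is_interval I \<and> (\<exists>s c. \<forall>x\<in>I. f x = s * x + c)))"

definition slope_change :: "(real \<Rightarrow> real) \<Rightarrow> real \<Rightarrow> real"
    (\<open>\<omega>\<close>)
  where "\<omega> f x = Lim (at_right 0) (\<lambda>\<epsilon>. deriv f (x + \<epsilon>) - deriv f (x - \<epsilon>))"

definition trop_pole :: "(real \<Rightarrow> real) \<Rightarrow> real \<Rightarrow> bool"
  where "trop_pole f x \<longleftrightarrow> \<omega> f x < 0"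

definition trop_multiplicity :: "(real \<Rightarrow> real) \<Rightarrow> real \<Rightarrow> real"
    (\<open>\<tau>\<close>)
  where "\<tau> f x = \<bar>\<omega> f x\<bar>"

definition proximity :: "real \<Rightarrow> (real \<Rightarrow> real) \<Rightarrow> real"
  where "proximity r f = (max (f r) 0 + max (f (- r)) 0) / 2"

definition counting :: "real \<Rightarrow> (real \<Rightarrow> real) \<Rightarrow> real"
  where "counting r f = (\<Sum>b | \<bar>b\<bar> < r \<and> trop_pole f b. \<tau> f b * (r - \<bar>b\<bar>)) / 2"

text \<open>\<open>jump f x\<close> is \<open>f(x+) - f(x-)\<close>. The factor \<open>sgn x\<close> orients it away from the origin; at the
  origin itself, where that direction is undefined, no jump counts as negative.\<close>

definition jump :: "(real \<Rightarrow> real) \<Rightarrow> real \<Rightarrow> real"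
  where "jump f x = Lim (at_right x) f - Lim (at_left x) f"

definition negative_jump :: "(real \<Rightarrow> real) \<Rightarrow> real \<Rightarrow> bool"
  where "negative_jump f x \<longleftrightarrow> sgn x * jump f x < 0"

definition jump_counting :: "real \<Rightarrow> (real \<Rightarrow> real) \<Rightarrow> real"
  where "jump_counting r f = (\<Sum>x | \<bar>x\<bar> \<le> r \<and> negative_jump f x. \<bar>jump f x\<bar>) / 2"

definition characteristic :: "real \<Rightarrow> (real \<Rightarrow> real) \<Rightarrow> real"
  where "characteristic r f = proximity r f + counting r f + jump_counting r f"

end

theory Submission imports Defs begin

text \<open>On \<open>[-r,r]\<close> a tropical meromorphic function \<open>g\<close> is \<open>c + s x + \<Sum> w\<^sub>b max (x - b) 0\<close> with finitely
  many kinks \<open>b\<close> and \<open>w\<^sub>b = \<omega>\<^sub>g(b)\<close>. Evaluating at \<open>r\<close>, \<open>-r\<close> and \<open>0\<close> gives the tropical Jensen formula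
  \<open>m(r,g) + N(r,g) = m(r,-g) + N(r,-g) + g(0)\<close>. For \<open>g = max f a\<close> this turns the claim into
  \<open>m(r,f) - m(r,g) + m(r,-g) + g(0) = o(T(r,f))\<close>. Here \<open>0 \<le> m(r,g) - m(r,f) \<le> m(r,a)\<close>, and the
  constant \<open>g(0)\<close> is negligible because \<open>T(r,f) \<rightarrow> \<infinity>\<close>: a pole makes \<open>N\<close> grow linearly, and
  a non-constant \<open>f\<close> without poles is convex.\<close>

section \<open>Piecewise affine functions as sums of hinges\<close>

text \<open>The difference from the affine function is continuous and vanishes on a dense subset of
  the closed interval. Including the endpoints is what later lets adjacent pieces be compared at a
  common breakpoint.\<close>

lemma affine_on_closed_interval:
  fixes f :: "real \<Rightarrow> real"
  assumes "continuous_on {u..v} f" "u < v" "\<And>x. u < x \<Longrightarrow> x < v \<Longrightarrow> f x = s * x + c"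
    and "x \<in> {u..v}"
  shows "f x = s * x + c"
proof -
  have cl: "closure {u<..<v} = {u..v}" using assms(2) by (rule closure_greaterThanLessThan)
  have "f x - (s * x + c) = 0"
  proof (rule continuous_constant_on_closure[where S = "{u<..<v}" and f = "\<lambda>x. f x - (s * x + c)"])
    show "continuous_on (closure {u<..<v}) (\<lambda>x. f x - (s * x + c))"
      unfolding cl by (intro continuous_intros assms(1))
    show "f x - (s * x + c) = 0" if "x \<in> {u<..<v}" for x
      using assms(3)[of x] that by simp
    show "x \<in> closure {u<..<v}" unfolding cl by (rule assms(4))
  qed
  then show ?thesis by simp
qed

text \<open>The endpoints of the covering pieces serve as breakpoints. Pieces may overlap or be
  degenerate, so they are not ordered; instead, the piece containing the midpoint of
  \<open>{u<..<v}\<close> has no endpoint inside that interval and hence contains all of it.\<close>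

lemma trop_meromorphic_breakpoints:
  assumes "trop_meromorphic f"
  obtains E where "finite E"
    and "\<And>u v. \<lbrakk>a \<le> u; u < v; v \<le> b; {u<..<v} \<inter> E = {}\<rbrakk> \<Longrightarrow> \<exists>s c. \<forall>x\<in>{u..v}. f x = s * x + c"
proof -
  from assms obtain \<I> where fin: "finite \<I>" and cover: "\<Union>\<I> = {a..b}"
    and aff: "\<forall>I\<in>\<I>. is_interval I \<and> (\<exists>s c. \<forall>x\<in>I. f x = s * x + c)"
    and cont: "continuous_on UNIV f"
    unfolding trop_meromorphic_def by blast
  define E where "E = Inf ` \<I> \<union> Sup ` \<I>"
  have "\<exists>s c. \<forall>x\<in>{u..v}. f x = s * x + c"
    if uv: "a \<le> u" "u < v" "v \<le> b" "{u<..<v} \<inter> E = {}" for u v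
  proof -
    define m where "m = (u + v) / 2"
    have m: "u < m" "m < v" using uv by (auto simp: m_def)
    then have "m \<in> \<Union>\<I>" using cover uv by simp
    then obtain I where I: "I \<in> \<I>" "m \<in> I" by blast
    have sub: "I \<subseteq> {a..b}" using I cover by blast
    have bdd: "bdd_below I" "bdd_above I"
      using sub by (auto intro: bdd_below_mono[OF bdd_below_Icc] bdd_above_mono[OF bdd_above_Icc])
    have "Inf I \<le> m" "m \<le> Sup I"
      using I bdd by (auto intro: cInf_lower cSup_upper)
    moreover have "Inf I \<notin> {u<..<v}" "Sup I \<notin> {u<..<v}"
      using uv(4) I by (auto simp: E_def)
    ultimately have ends: "Inf I \<le> u" "v \<le> Sup I" using m by auto
    have inside: "x \<in> I" if "u < x" "x < v" for x
    proof -
      have "\<exists>y\<in>I. y < x" using cInf_less_iff[of I x] I bdd ends that by force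
      moreover have "\<exists>z\<in>I. x < z" using less_cSup_iff[of I x] I bdd ends that by force
      ultimately show ?thesis
        using aff I by (meson is_interval_1 less_imp_le)
    qed
    obtain s c where "\<forall>x\<in>I. f x = s * x + c" using aff I by blast
    then have "\<forall>x\<in>{u..v}. f x = s * x + c"
      using affine_on_closed_interval[of u v f s c] inside uv cont continuous_on_subset
      by (metis subset_UNIV)
    then show ?thesis by blast
  qed
  moreover have "finite E" using fin by (simp add: E_def)
  ultimately show ?thesis using that by blast
qed

text \<open>Breakpoints are added from left to right, each correcting the slope by one hinge
  \<open>max (x - e) 0\<close>, which is invisible to the left of \<open>e\<close>. The right end
  \<open>b\<close> is generalized because the induction hypothesis is applied on
  \<open>{a..e}\<close>.\<close>

lemma piecewise_affine_hinge_sum: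
  fixes f :: "real \<Rightarrow> real"
  assumes "finite E" "a < b" "E \<subseteq> {a<..<b}"
    and "\<And>u v. \<lbrakk>a \<le> u; u < v; v \<le> b; {u<..<v} \<inter> E = {}\<rbrakk> \<Longrightarrow> \<exists>s c. \<forall>x\<in>{u..v}. f x = s * x + c"
  shows "\<exists>c s w. \<forall>x\<in>{a..b}. f x = c + s * x + (\<Sum>e\<in>E. w e * max (x - e) 0)"
  using assms
proof (induction E arbitrary: b rule: finite_linorder_max_induct)
  case empty
  then show ?case by (fastforce simp: add.commute)
next
  case (insert e E)
  have ae: "a < e" "e < b" using insert.prems by auto
  have "\<exists>c s w. \<forall>x\<in>{a..e}. f x = c + s * x + (\<Sum>e\<in>E. w e * max (x - e) 0)"
  proof (rule insert.IH)
    show "E \<subseteq> {a<..<e}" using insert by auto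
    show "\<exists>s c. \<forall>x\<in>{u..v}. f x = s * x + c"
      if "a \<le> u" "u < v" "v \<le> e" "{u<..<v} \<inter> E = {}" for u v
      using insert.prems(3)[of u v] that ae by auto
  qed (use ae in auto)
  then obtain c s w where
    left: "\<And>x. x \<in> {a..e} \<Longrightarrow> f x = c + s * x + (\<Sum>e\<in>E. w e * max (x - e) 0)" by blast
  have "{e<..<b} \<inter> insert e E = {}" using insert.hyps by force
  then obtain t d where right: "\<And>x. x \<in> {e..b} \<Longrightarrow> f x = t * x + d"
    using insert.prems(3)[of e b] ae by auto
  \<comment> \<open>All hinges of \<open>E\<close> lie below \<open>e\<close>, so the left formula
    continued past \<open>e\<close> has slope \<open>S\<close>. The new hinge must turn
    \<open>S\<close> into the slope \<open>t\<close> of the last piece.\<close>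
  define S where "S = s + sum w E"
  define w' where "w' = w(e := t - S)"
  have notin: "e \<notin> E" using insert.hyps by auto
  have sum': "(\<Sum>x\<in>insert e E. w' x * max (y - x) 0)
      = (t - S) * max (y - e) 0 + (\<Sum>x\<in>E. w x * max (y - x) 0)" for y
    using insert.hyps notin by (auto simp: w'_def intro!: sum.cong)
  have slope: "(\<Sum>x\<in>E. w x * max (y - x) 0) = (\<Sum>x\<in>E. w x * max (e - x) 0) + sum w E * (y - e)"
    if "e \<le> y" for y
  proof -
    have "(\<Sum>x\<in>E. w x * max (y - x) 0) = (\<Sum>x\<in>E. w x * max (e - x) 0 + w x * (y - e))"
      using that insert.hyps by (intro sum.cong) (force simp: max_def algebra_simps)+
    then show ?thesis by (simp add: sum.distrib sum_distrib_right)
  qed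
  have "f y = c + s * y + (\<Sum>x\<in>insert e E. w' x * max (y - x) 0)" if "y \<in> {a..b}" for y
  proof (cases "y \<le> e")
    case True
    then show ?thesis using left[of y] that unfolding sum' by simp
  next
    case False
    \<comment> \<open>The two closed intervals share the point \<open>e\<close>; this matches the
      constants of the two formulas.\<close>
    have "t * e + d = c + s * e + (\<Sum>x\<in>E. w x * max (e - x) 0)"
      using left[of e] right[of e] ae by simp
    then show ?thesis
      using right[of y] that False slope[of y] unfolding sum' by (simp add: S_def algebra_simps)
  qed
  then show ?case by blast
qed

text \<open>Only breakpoints in the open interval are kept: those outside do not subdivide
  \<open>{-r..r}\<close>, and the sum defining \<open>counting\<close> likewise ranges over
  \<open>\<bar>b\<bar> < r\<close>.\<close>

lemma trop_meromorphic_hinge_sum: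
  assumes "trop_meromorphic f" "0 < r"
  obtains B c s w where "finite B" "B \<subseteq> {-r<..<r}"
    and "\<And>x. x \<in> {-r..r} \<Longrightarrow> f x = c + s * x + (\<Sum>b\<in>B. w b * max (x - b) 0)"
proof -
  obtain E where E: "finite E"
    "\<And>u v. \<lbrakk>-r \<le> u; u < v; v \<le> r; {u<..<v} \<inter> E = {}\<rbrakk> \<Longrightarrow> \<exists>s c. \<forall>x\<in>{u..v}. f x = s * x + c"
    using trop_meromorphic_breakpoints[OF assms(1)] by metis
  have "\<exists>c s w. \<forall>x\<in>{-r..r}. f x = c + s * x + (\<Sum>e\<in>E \<inter> {-r<..<r}. w e * max (x - e) 0)"
  proof (rule piecewise_affine_hinge_sum)
    show "\<exists>s c. \<forall>x\<in>{u..v}. f x = s * x + c"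
      if "-r \<le> u" "u < v" "v \<le> r" "{u<..<v} \<inter> (E \<inter> {-r<..<r}) = {}" for u v
    proof -
      have "{u<..<v} \<inter> E = {}" using that by auto
      then show ?thesis using E(2) that by blast
    qed
  qed (use E assms in auto)
  then show ?thesis using that[of "E \<inter> {-r<..<r}"] E(1) by blast
qed

section \<open>Slope changes and the counting function\<close>

text \<open>Off its kink a hinge is locally either linear or zero. The open set \<open>U\<close>
  accommodates representations that hold only on a bounded interval.\<close>

lemma deriv_hinge_sum:
  fixes f :: "real \<Rightarrow> real"
  assumes "finite B" "y \<notin> B" "open U" "y \<in> U"
    and "\<And>x. x \<in> U \<Longrightarrow> f x = c + s * x + (\<Sum>b\<in>B. w b * max (x - b) 0)"
  shows "deriv f y = s + (\<Sum>b\<in>B. if b < y then w b else 0)"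
proof (rule DERIV_imp_deriv)
  have hinge: "((\<lambda>x. w b * max (x - b) 0) has_real_derivative (if b < y then w b else 0)) (at y)"
    if "b \<in> B" for b
  proof (cases "b < y")
    case True
    have "((\<lambda>x. w b * (x - b)) has_real_derivative w b) (at y)"
      by (auto intro!: derivative_eq_intros)
    then have "((\<lambda>x. w b * max (x - b) 0) has_real_derivative w b) (at y)"
      by (rule has_field_derivative_transform_within_open[where S = "{b<..}"]) (use True in auto)
    then show ?thesis using True by simp
  next
    case False
    then have "y < b" using that assms(2) by (metis linorder_neqE_linordered_idom)
    have "((\<lambda>x. 0) has_real_derivative 0) (at y)" by simp
    then have "((\<lambda>x. w b * max (x - b) 0) has_real_derivative 0) (at y)"
      by (rule has_field_derivative_transform_within_open[where S = "{..<b}"]) (use \<open>y < b\<close> in auto)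
    then show ?thesis using False by simp
  qed
  have "((\<lambda>x. c + s * x + (\<Sum>b\<in>B. w b * max (x - b) 0)) has_real_derivative
      s + (\<Sum>b\<in>B. if b < y then w b else 0)) (at y)"
    by (rule derivative_eq_intros hinge refl | assumption | simp)+
  then show "(f has_real_derivative s + (\<Sum>b\<in>B. if b < y then w b else 0)) (at y)"
    by (rule has_field_derivative_transform_within_open[OF _ assms(3,4)]) (use assms(5) in auto)
qed

lemma slope_change_hinge_sum:
  fixes f :: "real \<Rightarrow> real"
  assumes "finite B" "x \<in> {u<..<v}"
    and "\<And>x. x \<in> {u<..<v} \<Longrightarrow> f x = c + s * x + (\<Sum>b\<in>B. w b * max (x - b) 0)"
  shows "\<omega> f x = (if x \<in> B then w x else 0)"
proof -
  \<comment> \<open>\<open>D\<close> collects the distances from \<open>x\<close> to the other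
    hinges and to both ends of the interval. For \<open>0 < h < d\<close> the points
    \<open>x + h\<close> and \<open>x - h\<close> therefore stay in the interval, and no hinge
    except possibly \<open>x\<close> lies between them.\<close>
  define D where "D = (\<lambda>b. \<bar>b - x\<bar>) ` (B - {x}) \<union> {x - u, v - x}"
  define d where "d = Min D"
  have "finite D" using assms(1) by (simp add: D_def)
  moreover have "D \<noteq> {}" "\<forall>e\<in>D. 0 < e" using assms(2) by (auto simp: D_def)
  ultimately have "0 < d" by (simp add: d_def)
  have le: "d \<le> e" if "e \<in> D" for e
    using Min_le[OF \<open>finite D\<close> that] by (simp add: d_def)
  have d: "d \<le> x - u" "d \<le> v - x" "\<And>b. b \<in> B \<Longrightarrow> b \<noteq> x \<Longrightarrow> d \<le> \<bar>b - x\<bar>"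
    using le by (auto simp: D_def)
  have eq: "deriv f (x + h) - deriv f (x - h) = (if x \<in> B then w x else 0)"
    if h: "0 < h" "h < d" for h
  proof -
    have notin: "x + h \<notin> B" "x - h \<notin> B" using d(3)[of "x + h"] d(3)[of "x - h"] h by auto
    have D: "deriv f y = s + (\<Sum>b\<in>B. if b < y then w b else 0)" if "y \<in> {x + h, x - h}" for y
      by (rule deriv_hinge_sum[where U = "{u<..<v}"]) (use assms notin h d that in auto)
    have "deriv f (x + h) - deriv f (x - h)
        = (\<Sum>b\<in>B. (if b < x + h then w b else 0) - (if b < x - h then w b else 0))"
      by (simp add: D sum_subtractf)
    also have "\<dots> = (\<Sum>b\<in>B. if x = b then w b else 0)"
    proof (rule sum.cong)
      fix b assume "b \<in> B"
      then show "(if b < x + h then w b else 0) - (if b < x - h then w b else 0)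
          = (if x = b then w b else 0)"
        using d(3)[of b] h by (cases "b = x") auto
    qed simp
    finally show ?thesis using assms(1) by simp
  qed
  have "\<forall>\<^sub>F h in at_right 0. deriv f (x + h) - deriv f (x - h) = (if x \<in> B then w x else 0)"
    unfolding eventually_at_right_field using \<open>0 < d\<close> eq by blast
  then have "((\<lambda>h. deriv f (x + h) - deriv f (x - h)) \<longlongrightarrow> (if x \<in> B then w x else 0)) (at_right 0)"
    by (rule tendsto_eventually)
  then show ?thesis unfolding slope_change_def by (rule tendsto_Lim[OF trivial_limit_at_right_real])
qed

text \<open>The positive part discards the hinges that are not poles. Summing over all of
  \<open>B\<close> makes the counts for \<open>g\<close> and its negative comparable term by
  term.\<close>

lemma counting_eq_sum:
  assumes "finite B" "B \<subseteq> {-r<..<r}"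
    and "\<And>x. x \<in> {-r<..<r} \<Longrightarrow> \<omega> f x = (if x \<in> B then w x else 0)"
  shows "counting r f = (\<Sum>b\<in>B. max (- w b) 0 * (r - \<bar>b\<bar>)) / 2"
proof -
  have "{b. \<bar>b\<bar> < r \<and> trop_pole f b} = {b\<in>B. w b < 0}"
    using assms by (auto simp: trop_pole_def abs_less_iff split: if_splits)
  then have "(\<Sum>b | \<bar>b\<bar> < r \<and> trop_pole f b. \<tau> f b * (r - \<bar>b\<bar>))
      = (\<Sum>b\<in>{b\<in>B. w b < 0}. max (- w b) 0 * (r - \<bar>b\<bar>))"
    using assms by (auto simp: trop_multiplicity_def subset_iff intro!: sum.cong)
  also have "\<dots> = (\<Sum>b\<in>B. max (- w b) 0 * (r - \<bar>b\<bar>))"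
    using assms(1) by (intro sum.mono_neutral_left) auto
  finally show ?thesis by (simp add: counting_def)
qed

section \<open>The tropical Jensen formula\<close>

theorem tropical_Jensen:
  assumes "trop_meromorphic g" "0 < r"
  shows "proximity r g + counting r g
    = proximity r (\<one>\<^sub>\<circ> \<oslash> g) + counting r (\<one>\<^sub>\<circ> \<oslash> g) + g 0"
proof -
  obtain B c s w where B: "finite B" "B \<subseteq> {-r<..<r}"
    and g: "\<And>x. x \<in> {-r..r} \<Longrightarrow> g x = c + s * x + (\<Sum>b\<in>B. w b * max (x - b) 0)"
    using trop_meromorphic_hinge_sum[OF assms] by metis
  have neg: "(\<one>\<^sub>\<circ> \<oslash> g) x = - c + (- s) * x + (\<Sum>b\<in>B. - w b * max (x - b) 0)"
    if "x \<in> {-r<..<r}" for x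
    using g[of x] that by (simp add: trop_div_def trop_one_def sum_negf)
  have "\<omega> g x = (if x \<in> B then w x else 0)" if "x \<in> {-r<..<r}" for x
    by (rule slope_change_hinge_sum[OF B(1) that]) (use g in auto)
  then have N: "counting r g = (\<Sum>b\<in>B. max (- w b) 0 * (r - \<bar>b\<bar>)) / 2"
    by (rule counting_eq_sum[OF B])
  have "\<omega> (\<one>\<^sub>\<circ> \<oslash> g) x = (if x \<in> B then - w x else 0)" if "x \<in> {-r<..<r}" for x
    by (rule slope_change_hinge_sum[OF B(1) that neg])
  then have N': "counting r (\<one>\<^sub>\<circ> \<oslash> g) = (\<Sum>b\<in>B. max (- (- w b)) 0 * (r - \<bar>b\<bar>)) / 2"
    by (rule counting_eq_sum[OF B])
  have "counting r (\<one>\<^sub>\<circ> \<oslash> g) - counting r g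
      = (\<Sum>b\<in>B. max (- (- w b)) 0 * (r - \<bar>b\<bar>) - max (- w b) 0 * (r - \<bar>b\<bar>)) / 2"
    by (simp add: N N' sum_subtractf diff_divide_distrib)
  \<comment> \<open>Uses \<open>max w 0 - max (- w) 0 = w\<close>: roots and poles merge into one
    signed sum.\<close>
  also have "\<dots> = (\<Sum>b\<in>B. w b * (r - \<bar>b\<bar>)) / 2"
    by (intro arg_cong[where f = "\<lambda>t. t / 2"] sum.cong) (auto simp: max_def)
  finally have counts: "counting r (\<one>\<^sub>\<circ> \<oslash> g) - counting r g = (\<Sum>b\<in>B. w b * (r - \<bar>b\<bar>)) / 2" .
  \<comment> \<open>The symmetric second difference about 0 annihilates the affine part
    \<open>c + s * x\<close>, leaving only the hinges.\<close>
  have "g r + g (- r) - 2 * g 0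
      = (\<Sum>b\<in>B. w b * max (r - b) 0 + w b * max (- r - b) 0 - 2 * (w b * max (0 - b) 0))"
    using g[of r] g[of "-r"] g[of 0] assms(2)
    by (simp add: sum.distrib sum_subtractf sum_distrib_left)
  \<comment> \<open>Since \<open>- r < b < r\<close>, the term at \<open>- r\<close> vanishes and
    the one at \<open>r\<close> is \<open>r - b\<close>; subtracting \<open>2 * max (- b) 0\<close>
    turns \<open>b\<close> into \<open>\<bar>b\<bar>\<close>.\<close>
  also have "\<dots> = (\<Sum>b\<in>B. w b * (r - \<bar>b\<bar>))"
    using B(2) by (intro sum.cong) (force simp: max_def abs_if algebra_simps)+
  finally have vals: "g r + g (- r) - 2 * g 0 = (\<Sum>b\<in>B. w b * (r - \<bar>b\<bar>))" .
  have "max t 0 - max (- t) 0 = t" for t :: real by (simp add: max_def)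
  from this[of "g r"] this[of "g (- r)"]
  have "proximity r g - proximity r (\<one>\<^sub>\<circ> \<oslash> g) = (g r + g (- r)) / 2"
    by (simp add: proximity_def trop_div_def trop_one_def field_simps)
  with counts vals show ?thesis by simp
qed

section \<open>Closure under maxima and absence of jumps\<close>

text \<open>Each intersection of a piece of \<open>f\<close> with a piece of \<open>g\<close> is cut
  by comparing the two functions. Both are affine there, so either comparison describes a half-line,
  the empty set or the whole line, and each part remains an interval. The two parts overlap where
  \<open>f\<close> and \<open>g\<close> agree, which a cover permits.\<close>

lemma trop_meromorphic_trop_add:
  assumes "trop_meromorphic f" "trop_meromorphic g"
  shows "trop_meromorphic (f \<oplus> g)"
  unfolding trop_meromorphic_def
proof (intro conjI allI)
  show "continuous_on UNIV (f \<oplus> g)"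
    using assms unfolding trop_meromorphic_def trop_add_def by (auto intro: continuous_intros)
  fix a b :: real
  obtain \<I> where \<I>: "finite \<I>" "\<Union>\<I> = {a..b}"
    "\<forall>I\<in>\<I>. is_interval I \<and> (\<exists>s c. \<forall>x\<in>I. f x = s * x + c)"
    using assms(1) unfolding trop_meromorphic_def by blast
  obtain \<J> where \<J>: "finite \<J>" "\<Union>\<J> = {a..b}"
    "\<forall>J\<in>\<J>. is_interval J \<and> (\<exists>s c. \<forall>x\<in>J. g x = s * x + c)"
    using assms(2) unfolding trop_meromorphic_def by blast
  define P where "P = (\<lambda>(I, J). I \<inter> J \<inter> {x. f x \<le> g x})"
  define Q where "Q = (\<lambda>(I, J). I \<inter> J \<inter> {x. g x \<le> f x})"
  define \<K> where "\<K> = P ` (\<I> \<times> \<J>) \<union> Q ` (\<I> \<times> \<J>)"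
  have half: "is_interval (I \<inter> J \<inter> {x. h x \<le> k x})"
    if "is_interval I" "is_interval J" "\<forall>x\<in>I \<inter> J. h x = s * x + c" "\<forall>x\<in>I \<inter> J. k x = s' * x + c'"
    for I J :: "real set" and h k s c s' c'
  proof -
    have "I \<inter> J \<inter> {x. h x \<le> k x} = I \<inter> J \<inter> {x. (s - s') * x \<le> c' - c}"
      using that by (auto simp: algebra_simps)
    moreover have "is_interval {x. (s - s') * x \<le> c' - c}"
      using convex_halfspace_le[of "s - s'" "c' - c"] by (simp add: is_interval_convex_1)
    ultimately show ?thesis using that by (simp add: is_interval_Int)
  qed
  have "finite \<K>" using \<I>(1) \<J>(1) by (simp add: \<K>_def)
  moreover have "\<Union>\<K> = {a..b}"
  proof -
    have "\<Union>\<K> = \<Union>\<I> \<inter> \<Union>\<J>"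
      unfolding \<K>_def P_def Q_def by (fastforce simp: le_cases)
    then show ?thesis using \<I>(2) \<J>(2) by simp
  qed
  moreover have "is_interval K \<and> (\<exists>s c. \<forall>x\<in>K. (f \<oplus> g) x = s * x + c)" if mem: "K \<in> \<K>" for K
  proof -
    obtain I J where IJ: "I \<in> \<I>" "J \<in> \<J>" "K = P (I, J) \<or> K = Q (I, J)"
      using mem unfolding \<K>_def by blast
    have int: "is_interval I" "is_interval J" using \<I>(3) \<J>(3) IJ by auto
    obtain s c where f: "\<forall>x\<in>I. f x = s * x + c" using \<I>(3) IJ by blast
    obtain s' c' where g: "\<forall>x\<in>J. g x = s' * x + c'" using \<J>(3) IJ by blast
    from IJ(3) show ?thesis
    proof
      assume K: "K = P (I, J)"
      have "is_interval K"
        unfolding K P_def prod.case by (rule half[OF int]) (use f g in auto)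
      moreover have "\<forall>x\<in>K. (f \<oplus> g) x = s' * x + c'"
        using g unfolding K P_def trop_add_def by (auto simp: max_def)
      ultimately show ?thesis by blast
    next
      assume K: "K = Q (I, J)"
      have "is_interval K"
        unfolding K Q_def prod.case by (rule half[OF int]) (use f g in auto)
      moreover have "\<forall>x\<in>K. (f \<oplus> g) x = s * x + c"
        using f unfolding K Q_def trop_add_def by (auto simp: max_def)
      ultimately show ?thesis by blast
    qed
  qed
  ultimately show "\<exists>\<K>. finite \<K> \<and> \<Union>\<K> = {a..b} \<and>
      (\<forall>K\<in>\<K>. is_interval K \<and> (\<exists>s c. \<forall>x\<in>K. (f \<oplus> g) x = s * x + c))"
    by blast
qed

lemma jump_counting_continuous:
  assumes "continuous_on UNIV f"
  shows "jump_counting r f = 0"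
proof -
  have "isCont f x" for x
    using assms by (simp add: continuous_on_eq_continuous_at)
  then have "jump f x = 0" for x
    unfolding jump_def isCont_def
    by (metis at_within_le_at diff_self tendsto_Lim tendsto_mono trivial_limit_at_left_real
        trivial_limit_at_right_real)
  then show ?thesis by (simp add: jump_counting_def negative_jump_def)
qed

section \<open>Growth of the characteristic\<close>

lemma proximity_nonneg: "0 \<le> proximity r f"
  by (simp add: proximity_def)

lemma counting_nonneg: "0 \<le> counting r f"
  by (auto simp: counting_def trop_multiplicity_def intro!: sum_nonneg divide_nonneg_pos)

lemma jump_counting_nonneg: "0 \<le> jump_counting r f"
  by (auto simp: jump_counting_def intro!: sum_nonneg divide_nonneg_pos)

text \<open>A sum over an infinite set is 0 by convention; finiteness ensures that
  \<open>counting\<close> is a genuine sum, bounded below by each of its terms.\<close>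

lemma finite_trop_poles:
  assumes "trop_meromorphic f"
  shows "finite {b. \<bar>b\<bar> < r \<and> trop_pole f b}"
proof (cases "0 < r")
  case True
  obtain B c s w where B: "finite B" "B \<subseteq> {-r<..<r}"
    and f: "\<And>x. x \<in> {-r..r} \<Longrightarrow> f x = c + s * x + (\<Sum>b\<in>B. w b * max (x - b) 0)"
    using trop_meromorphic_hinge_sum[OF assms True] by metis
  have "\<omega> f x = (if x \<in> B then w x else 0)" if "x \<in> {-r<..<r}" for x
    by (rule slope_change_hinge_sum[OF B(1) that]) (use f in auto)
  then have "{b. \<bar>b\<bar> < r \<and> trop_pole f b} \<subseteq> B"
    by (auto simp: trop_pole_def abs_less_iff split: if_splits)
  then show ?thesis using B(1) finite_subset by blast
next
  case False
  then have "{b. \<bar>b\<bar> < r \<and> trop_pole f b} = {}" by auto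
  then show ?thesis by (metis finite.emptyI)
qed

text \<open>Without poles all hinge coefficients are nonnegative, and hinges are convex. A
  representation on one bounded interval suffices, since the convexity inequality involves only
  \<open>x\<close>, \<open>y\<close> and a point between them.\<close>

lemma convex_on_if_no_trop_poles:
  assumes "trop_meromorphic f" "\<And>x. \<not> trop_pole f x"
  shows "convex_on UNIV f"
proof (rule convex_onI[OF _ convex_UNIV])
  fix t x y :: real
  assume t: "0 < t" "t < 1"
  define r where "r = max \<bar>x\<bar> \<bar>y\<bar> + 1"
  have "0 < r" by (simp add: r_def)
  obtain B c s w where B: "finite B" "B \<subseteq> {-r<..<r}"
    and f: "\<And>x. x \<in> {-r..r} \<Longrightarrow> f x = c + s * x + (\<Sum>b\<in>B. w b * max (x - b) 0)"
    using trop_meromorphic_hinge_sum[OF assms(1) \<open>0 < r\<close>] by metis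
  have om: "\<omega> f x = (if x \<in> B then w x else 0)" if "x \<in> {-r<..<r}" for x
    by (rule slope_change_hinge_sum[OF B(1) that]) (use f in auto)
  have w: "0 \<le> w b" if "b \<in> B" for b
    using om[of b] that B(2) assms(2)[of b] by (auto simp: trop_pole_def)
  define z where "z = (1 - t) * x + t * y"
  have xy: "x \<in> {-r..r}" "y \<in> {-r..r}" by (auto simp: r_def)
  then have z: "z \<in> {-r..r}"
    using convexD[of "{-r..r}" x y "1 - t" t] t by (simp add: z_def convex_real_interval)
  have hinge: "max (z - b) 0 \<le> (1 - t) * max (x - b) 0 + t * max (y - b) 0" for b
  proof -
    have "z - b = (1 - t) * (x - b) + t * (y - b)" by (simp add: z_def algebra_simps)
    also have "\<dots> \<le> (1 - t) * max (x - b) 0 + t * max (y - b) 0"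
      using t by (intro add_mono mult_left_mono) auto
    finally show ?thesis using t by simp
  qed
  have "f z = c + s * z + (\<Sum>b\<in>B. w b * max (z - b) 0)" using f z by blast
  also have "\<dots> \<le> c + s * z + (\<Sum>b\<in>B. w b * ((1 - t) * max (x - b) 0 + t * max (y - b) 0))"
    by (intro add_left_mono sum_mono mult_left_mono hinge w)
  also have "\<dots> = (1 - t) * f x + t * f y"
    using f xy by (simp add: z_def algebra_simps sum.distrib sum_subtractf sum_distrib_left)
  finally show "f ((1 - t) *\<^sub>R x + t *\<^sub>R y) \<le> (1 - t) * f x + t * f y"
    by (simp add: z_def)
qed

lemma filterlim_affine_at_top:
  fixes k :: real
  assumes "0 < k"
  shows "filterlim (\<lambda>x. c + k * (x - d)) at_top at_top"
proof -
  have "filterlim (\<lambda>x. - d + x) at_top at_top"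
    by (rule filterlim_tendsto_add_at_top[OF tendsto_const filterlim_ident])
  from filterlim_tendsto_add_at_top[OF tendsto_const
      filterlim_tendsto_pos_mult_at_top[OF tendsto_const assms this]]
  show ?thesis by simp
qed

text \<open>Secant slopes from \<open>x\<close> are nondecreasing, so beyond \<open>y\<close> the
  function stays above the increasing line through its values at \<open>x\<close> and
  \<open>y\<close>.\<close>

lemma convex_on_filterlim_at_top:
  fixes f :: "real \<Rightarrow> real"
  assumes "convex_on UNIV f" "x < y" "f x < f y"
  shows "filterlim f at_top at_top"
proof (rule filterlim_at_top_mono)
  define k where "k = (f y - f x) / (y - x)"
  have "0 < k" using assms by (simp add: k_def)
  then show "filterlim (\<lambda>z. f x + k * (z - x)) at_top at_top" by (rule filterlim_affine_at_top)
  show "\<forall>\<^sub>F z in at_top. f x + k * (z - x) \<le> f z"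
    using eventually_gt_at_top[of y]
  proof eventually_elim
    case (elim z)
    have "(f x - f y) / (x - y) \<le> (f x - f z) / (x - z)"
      using convex_on_slope_le[OF assms(1), of x z y] assms(2) elim by simp
    then have "k \<le> (f z - f x) / (z - x)"
      unfolding k_def by (metis minus_diff_eq minus_divide_divide)
    then show ?case using elim assms(2) by (simp add: field_simps)
  qed
qed

lemma filterlim_characteristic:
  assumes "trop_meromorphic f" "\<not> f constant_on UNIV"
  shows "filterlim (\<lambda>r. characteristic r f) at_top at_top"
proof (cases "\<exists>p. trop_pole f p")
  case True
  then obtain p where p: "trop_pole f p" by blast
  have "0 < \<tau> f p" using p by (simp add: trop_pole_def trop_multiplicity_def)
  show ?thesis
  proof (rule filterlim_at_top_mono)
    show "filterlim (\<lambda>r. \<tau> f p * (r - \<bar>p\<bar>) / 2) at_top at_top"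
      using filterlim_affine_at_top[of "\<tau> f p / 2" 0 "\<bar>p\<bar>"] \<open>0 < \<tau> f p\<close> by simp
    show "\<forall>\<^sub>F r in at_top. \<tau> f p * (r - \<bar>p\<bar>) / 2 \<le> characteristic r f"
      using eventually_gt_at_top[of "\<bar>p\<bar>"]
    proof eventually_elim
      case (elim r)
      \<comment> \<open>All terms are nonnegative, so the single term of \<open>p\<close> bounds the
        sum from below.\<close>
      have "\<tau> f p * (r - \<bar>p\<bar>) \<le> (\<Sum>b | \<bar>b\<bar> < r \<and> trop_pole f b. \<tau> f b * (r - \<bar>b\<bar>))"
        using p elim finite_trop_poles[OF assms(1)]
        by (intro member_le_sum) (auto simp: trop_multiplicity_def)
      then have "\<tau> f p * (r - \<bar>p\<bar>) / 2 \<le> counting r f" by (simp add: counting_def)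
      then show ?case
        using proximity_nonneg[of r f] jump_counting_nonneg[of r f] by (simp add: characteristic_def)
    qed
  qed
next
  case False
  then have convex: "convex_on UNIV f" using convex_on_if_no_trop_poles[OF assms(1)] by blast
  have "f r / 2 \<le> proximity r f \<and> f (- r) / 2 \<le> proximity r f" for r
    unfolding proximity_def by (auto intro!: divide_right_mono)
  then have ge: "f r / 2 \<le> characteristic r f" "f (- r) / 2 \<le> characteristic r f" for r
    using counting_nonneg[of r f] jump_counting_nonneg[of r f]
    unfolding characteristic_def by (smt (verit))+
  obtain x y where "f x \<noteq> f y" using assms(2) unfolding constant_on_def by blast
  then obtain x y where xy: "x < y" "f x \<noteq> f y" by (metis linorder_neqE_linordered_idom)
  have half: "filterlim (\<lambda>r. h r / 2) at_top at_top" if "filterlim h at_top at_top" for h :: "real \<Rightarrow> real"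
    using filterlim_tendsto_pos_mult_at_top[OF tendsto_const[of "1/2"] _ that] by simp
  show ?thesis
  proof (cases "f x < f y")
    case True
    then have "filterlim f at_top at_top" using convex_on_filterlim_at_top[OF convex] xy by blast
    then show ?thesis
      using filterlim_at_top_mono[OF half] ge(1) by (simp add: always_eventually)
  next
    case False
    \<comment> \<open>Here \<open>f x > f y\<close>, so \<open>f\<close> grows towards minus
      infinity. Reflection reduces this to the previous case, and the term \<open>f (- r)\<close> of
      the proximity function detects the growth.\<close>
    have "convex_on UNIV (\<lambda>z. f (- z))"
    proof (rule convex_onI)
      fix t u v :: real
      assume "0 < t" "t < 1"
      then show "f (- ((1 - t) *\<^sub>R u + t *\<^sub>R v)) \<le> (1 - t) * f (- u) + t * f (- v)"
        using convex_onD[OF convex, of t "- u" "- v"] by (simp add: algebra_simps)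
    qed simp
    then have "filterlim (\<lambda>z. f (- z)) at_top at_top"
      using convex_on_filterlim_at_top[of "\<lambda>z. f (- z)" "- y" "- x"] xy False by simp
    then show ?thesis
      using filterlim_at_top_mono[OF half] ge(2) by (simp add: always_eventually)
  qed
qed

section \<open>Reduction to negligible error terms\<close>

theorem theorem2p9:
  fixes f a :: "real \<Rightarrow> real"
  assumes "trop_meromorphic f"
    and "trop_meromorphic a"
    and "\<not> f constant_on UNIV"
    and "(\<lambda>r. proximity r a) \<in> o[at_top](\<lambda>r. characteristic r f)"
    and "(\<lambda>r. proximity r (\<one>\<^sub>\<circ> \<oslash> (f \<oplus> a))) \<in> o[at_top](\<lambda>r. characteristic r f)"
  shows "(\<lambda>r. characteristic r f -
             (counting r (\<one>\<^sub>\<circ> \<oslash> (f \<oplus> a)) + jump_counting r (\<one>\<^sub>\<circ> \<oslash> (f \<oplus> a))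
              + counting r f - counting r (f \<oplus> a)
              + jump_counting r f - jump_counting r (f \<oplus> a)))
         \<in> o[at_top](\<lambda>r. characteristic r f)"
proof -
  define g where "g = f \<oplus> a"
  have g: "trop_meromorphic g" using trop_meromorphic_trop_add assms(1,2) by (simp add: g_def)
  then have "continuous_on UNIV g" by (simp add: trop_meromorphic_def)
  then have "continuous_on UNIV (\<one>\<^sub>\<circ> \<oslash> g)"
    unfolding trop_div_def trop_one_def by (intro continuous_intros)
  note J = jump_counting_continuous[OF this] jump_counting_continuous[OF \<open>continuous_on UNIV g\<close>]
  have prox: "\<bar>proximity r f - proximity r g\<bar> \<le> proximity r a" for r
  proof -
    \<comment> \<open>With \<open>g = max f a\<close>, passing from \<open>f\<close> to
      \<open>g\<close> raises the positive part at each of the points \<open>r\<close> and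
      \<open>- r\<close> by at most the positive part of \<open>a\<close>.\<close>
    have max: "\<bar>max u 0 - max (max u v) 0\<bar> \<le> max v 0" for u v :: real by (simp add: max_def)
    have "\<bar>(p + p') / 2 - (q + q') / 2\<bar> \<le> (s + s') / 2"
      if "\<bar>p - q\<bar> \<le> s" "\<bar>p' - q'\<bar> \<le> s'" for p p' q q' s s' :: real
      using that unfolding add_divide_distrib by linarith
    from this[OF max max] show ?thesis
      unfolding g_def proximity_def trop_add_def .
  qed
  have "\<forall>\<^sub>F r in at_top. norm (proximity r f - proximity r g) \<le> 1 * norm (proximity r a)"
    using prox by (simp add: proximity_nonneg)
  then have "(\<lambda>r. proximity r f - proximity r g) \<in> O[at_top](\<lambda>r. proximity r a)"
    by (rule landau_o.bigI[rotated]) simp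
  then have "(\<lambda>r. proximity r f - proximity r g) \<in> o[at_top](\<lambda>r. characteristic r f)"
    using assms(4) by (rule landau_o.big_small_trans)
  moreover have "(\<lambda>r. g 0) \<in> o[at_top](\<lambda>r. characteristic r f)"
  proof (rule smalloI_tendsto)
    have lim: "filterlim (\<lambda>r. characteristic r f) at_top at_top"
      using filterlim_characteristic assms(1,3) by blast
    then show "((\<lambda>r. g 0 / characteristic r f) \<longlongrightarrow> 0) at_top"
      using tendsto_divide_0[OF tendsto_const filterlim_mono[OF _ at_top_le_at_infinity order_refl]]
      by blast
    show "\<forall>\<^sub>F r in at_top. characteristic r f \<noteq> 0"
      using lim by (rule filterlim_at_top_imp_at_infinity[THEN filterlim_at_infinity_imp_eventually_ne])
  qed
  ultimately have "(\<lambda>r. (proximity r f - proximity r g) + proximity r (\<one>\<^sub>\<circ> \<oslash> g) + g 0)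
      \<in> o[at_top](\<lambda>r. characteristic r f)" (is "?h \<in> _")
    using assms(5)[folded g_def] sum_in_smallo(1) by blast
  \<comment> \<open>The terms \<open>counting r f\<close> and \<open>jump_counting r f\<close>
    cancel against those in \<open>characteristic r f\<close>, and the jump terms of
    \<open>g\<close> and its negative are 0. Jensen's formula for \<open>g\<close> then gives the
    identity; it holds only eventually because the formula requires \<open>0 < r\<close>.\<close>
  moreover have "\<forall>\<^sub>F r in at_top. ?h r = characteristic r f -
      (counting r (\<one>\<^sub>\<circ> \<oslash> g) + jump_counting r (\<one>\<^sub>\<circ> \<oslash> g) + counting r f - counting r g
        + jump_counting r f - jump_counting r g)"
    using eventually_gt_at_top[of 0]
  proof eventually_elim
    case (elim r)
    then show ?case
      using tropical_Jensen[OF g elim] by (simp add: characteristic_def J)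
  qed
  ultimately show ?thesis
    unfolding g_def by (simp only: landau_o.small.in_cong)
qed

end
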